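(* Let $n\ge 2$. If $T:\mathbb{S}^n_+\to\mathbb{S}^n_+$ is a bijective $1$-Lipschitz map, then $T$ is an isometry fixing $N$. In particular, the image (push-forward) of $\sigma_+$ under $T$ is $\sigma_+$.
   Context: $\mathbb{S}^n$ is the unit Euclidean sphere of $\mathbb{R}^{n+1}$, equipped with its geodesic distance $d(x,y)=\arccos(x\cdot y)$. $\mathbb{S}^n_+=\{x\in\mathbb{S}^n: x_{n+1}\ge 0\}$ is the closed upper hemisphere (with the restricted distance $d$), $N=(0,\ldots,0,1)$ is the north pole, and $\sigma_+$ is the uniform probability measure on $\mathbb{S}^n_+$. "$1$-Lipschitz" and "isometry" are with respect to $d$. *)

theory Defs
  imports "HOL-Analysis.Analysis"
begin

(* The space R^(n+1), with n = CARD('n), is rendered as R^n \<times> R: the inner product on the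
   product type is the Euclidean one, and snd x is the last coordinate of x.
   The unit sphere S^n is sphere 0 1. *)

definition geodist :: "'a::real_inner \<Rightarrow> 'a \<Rightarrow> real"
  where "geodist x y = arccos (x \<bullet> y)"

definition upper_hemisphere :: "((real^'n) \<times> real) set"
  where "upper_hemisphere = {x \<in> sphere 0 1. snd x \<ge> 0}"

definition north_pole :: "(real^'n) \<times> real"
  where "north_pole = (0, 1)"

(* Normalised surface measure on the unit sphere, as a Borel measure on the ambient space
   concentrated on sphere 0 1: the measure of A is the proportion of the volume of the unit
   ball taken by the cone over A. Note sgn x = x /\<^sub>R norm x; the value sgn 0 = 0 is
   irrelevant, the origin being a null set. *)
definition uniform_sphere :: "'a::euclidean_space measure"
  where "uniform_sphere = distr (uniform_measure lborel (ball 0 1)) borel sgn"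

(* The conditional probability given the hemisphere, regarded as a measure on the hemisphere
   itself with its Borel sets. *)
definition uniform_hemisphere :: "((real^'n) \<times> real) measure"
  where "uniform_hemisphere =
    restrict_space (uniform_measure uniform_sphere upper_hemisphere) upper_hemisphere"

end

theory Submission
  imports Defs
begin

text \<open>
  Two facts of independent interest carry the proof.

  A nonexpansive map of a compact metric space onto itself is an isometry
  (\<open>compact_nonexpansive_surj_isometry\<close>). Going backwards along preimages never
  decreases distances, while compactness makes a backward orbit of a pair of points return
  arbitrarily close to where it started, so no distance can have increased along the way. On the
  unit sphere the angle is a monotone function of the chordal distance and of the inner product,
  so the fact applies to the hemisphere with the Euclidean metric, and \<open>T\<close>
  preserves inner products. The north pole is the only point of the hemisphere that has a
  nonnegative inner product with every other one, hence it is fixed.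

  A map of the hemisphere that preserves inner products extends to the sphere as an odd map that
  still does, and from there to a linear orthogonal transformation of the whole space. Lebesgue
  measure is invariant under these (\<open>lborel_distr_orthogonal\<close>): by Vitali's covering theorem
  an open set is, up to a null set, a disjoint union of balls, and an orthogonal transformation
  takes balls to balls of the same radius. As the unit ball is invariant too and radial projection
  commutes with orthogonal maps, the uniform measure on the sphere is invariant, and so is its
  restriction to the hemisphere, which \<open>T\<close> maps onto itself.
\<close>

section \<open>Nonexpansive surjections of compact metric spaces\<close>

text \<open>
  The points \<open>x\<close> and \<open>y\<close> are placed at time 1 of backward orbits that start at \<open>f x\<close> and
  \<open>f y\<close>. Distances grow along the pair of orbits, but the pair returns near its start; this
  squeezes the distance of \<open>x\<close> and \<open>y\<close> below that of their images.
\<close>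

lemma compact_nonexpansive_surj_isometry:
  fixes f :: "'a::metric_space \<Rightarrow> 'a"
  assumes "compact S" and surj: "f ` S = S"
    and nonexp: "\<And>x y. x \<in> S \<Longrightarrow> y \<in> S \<Longrightarrow> dist (f x) (f y) \<le> dist x y"
    and x: "x \<in> S" and y: "y \<in> S"
  shows "dist (f x) (f y) = dist x y"
proof (rule antisym)
  define g where "g = inv_into S f"
  have g: "g z \<in> S" "f (g z) = z" if "z \<in> S" for z
    using that surj by (auto simp: g_def inv_into_into f_inv_into_f)
  \<comment> \<open>As \<open>f\<close> may fail to be injective, \<open>g (f z)\<close> can differ from \<open>z\<close>; hence the separate case
      for time 0, which keeps \<open>z\<close> itself at time 1.\<close>
  define orb where "orb z n = (case n of 0 \<Rightarrow> f z | Suc m \<Rightarrow> (g ^^ m) z)" for z n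
  have pow: "(g ^^ m) z \<in> S" if "z \<in> S" for z m
    using that g by (induction m) auto
  have orb_in: "orb z n \<in> S" if "z \<in> S" for z n
    using that surj pow by (auto simp: orb_def split: nat.split)
  have f_orb: "f (orb z (Suc n)) = orb z n" if "z \<in> S" for z n
    using that g pow by (auto simp: orb_def split: nat.split)
  have mono: "dist (orb a i) (orb b j) \<le> dist (orb a (i + k)) (orb b (j + k))"
    if "a \<in> S" "b \<in> S" for a b i j k
  proof (induction k)
    case (Suc k)
    have "dist (orb a (i + k)) (orb b (j + k)) \<le> dist (orb a (Suc (i + k))) (orb b (Suc (j + k)))"
      using nonexp[OF orb_in[OF that(1)] orb_in[OF that(2)], of "Suc (i + k)" "Suc (j + k)"]
      by (simp add: f_orb that)
    with Suc show ?case by simp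
  qed simp
  show "dist x y \<le> dist (f x) (f y)"
  proof (rule field_le_epsilon)
    fix e :: real assume "e > 0"
    have "compact (S \<times> S)" using \<open>compact S\<close> by (intro compact_Times)
    moreover have "\<forall>n. (orb x n, orb y n) \<in> S \<times> S" using orb_in x y by auto
    ultimately obtain l r where r: "strict_mono r"
      and lim: "((\<lambda>n. (orb x n, orb y n)) \<circ> r) \<longlonglongrightarrow> l"
      unfolding compact_def by meson
    have "Cauchy ((\<lambda>n. (orb x n, orb y n)) \<circ> r)"
      using lim by (rule LIMSEQ_imp_Cauchy)
    from metric_CauchyD[OF this half_gt_zero[OF \<open>e > 0\<close>]]
    obtain M where M: "\<And>m n. m \<ge> M \<Longrightarrow> n \<ge> M \<Longrightarrow>
        dist (orb x (r m), orb y (r m)) (orb x (r n), orb y (r n)) < e / 2"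
      by auto
    define m where "m = r M"
    have "r M < r (Suc M)" using r by (simp add: strict_mono_Suc_iff)
    then obtain k where k: "r (Suc M) = m + Suc k"
      by (auto simp: m_def dest: less_imp_Suc_add)
    have close: "dist (orb x m, orb y m) (orb x (m + Suc k), orb y (m + Suc k)) < e / 2"
      using M[of M "Suc M"] by (simp add: m_def[symmetric] k)
    have dx: "dist (orb x 0) (orb x (Suc k)) < e / 2"
      using mono[OF x x, of 0 "Suc k" m] close
        dist_fst_le[of "(orb x m, orb y m)" "(orb x (m + Suc k), orb y (m + Suc k))"]
      by (simp add: add.commute)
    have dy: "dist (orb y 0) (orb y (Suc k)) < e / 2"
      using mono[OF y y, of 0 "Suc k" m] close
        dist_snd_le[of "(orb x m, orb y m)" "(orb x (m + Suc k), orb y (m + Suc k))"]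
      by (simp add: add.commute)
    have "dist x y = dist (orb x 1) (orb y 1)" by (simp add: orb_def)
    also have "\<dots> \<le> dist (orb x (Suc k)) (orb y (Suc k))"
      using mono[OF x y, of 1 1 k] by simp
    also have "\<dots> \<le> dist (orb x 0) (orb y 0) + e"
      using dx dy dist_triangle[of "orb x (Suc k)" "orb y (Suc k)" "orb x 0"]
        dist_triangle[of "orb x 0" "orb y (Suc k)" "orb y 0"]
      by (simp add: dist_commute)
    also have "orb x 0 = f x" by (simp add: orb_def)
    also have "orb y 0 = f y" by (simp add: orb_def)
    finally show "dist x y \<le> dist (f x) (f y) + e" .
  qed
qed (use nonexp x y in auto)

section \<open>Invariance of Lebesgue measure under orthogonal transformations\<close>

text \<open>
  A Vitali cover by balls contained in \<open>U\<close> is carried by \<open>f\<close> to a family of balls with the same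
  radii, so both sides are the same sum; the exceptional null set stays null since \<open>f\<close> is
  Lipschitz.
\<close>

lemma emeasure_lborel_orthogonal_image_open:
  fixes f :: "'a::euclidean_space \<Rightarrow> 'a"
  assumes f: "orthogonal_transformation f" and U: "open U"
  shows "emeasure lborel (f ` U) = emeasure lborel U"
proof -
  define K where "K = {(x, r). 0 < r \<and> ball x r \<subseteq> U}"
  have "\<exists>i. i \<in> K \<and> x \<in> ball (fst i) (snd i) \<and> snd i < d" if x: "x \<in> U" and "0 < d" for x d
  proof -
    obtain e where e: "e > 0" "ball x e \<subseteq> U" using U x by (meson openE)
    have "ball x (min e (d / 2)) \<subseteq> U" using e by (auto simp: subset_iff)
    then show ?thesis
      using e \<open>0 < d\<close> by (intro exI[of _ "(x, min e (d / 2))"]) (auto simp: K_def)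
  qed
  then obtain C where C: "countable C" "C \<subseteq> K"
    and disj: "pairwise (\<lambda>i j. disjnt (ball (fst i) (snd i)) (ball (fst j) (snd j))) C"
    and neg: "negligible (U - (\<Union>i\<in>C. ball (fst i) (snd i)))"
    by (rule Vitali_covering_theorem_balls[of U K fst snd])
  define B where "B = (\<Union>i\<in>C. ball (fst i) (snd i))"
  have "B \<subseteq> U" using C(2) by (fastforce simp: B_def K_def)
  have lin: "linear f" and inj: "inj f"
    using f by (auto intro: orthogonal_transformation_linear orthogonal_transformation_inj)
  have disjf: "disjoint_family_on (\<lambda>i. ball (fst i) (snd i)) C"
    using disj by (auto simp: pairwise_def disjoint_family_on_def disjnt_def)
  have fB: "f ` B = (\<Union>i\<in>C. ball (f (fst i)) (snd i))"
    by (simp add: B_def image_UN image_orthogonal_transformation_ball[OF f])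
  have disjf': "disjoint_family_on (\<lambda>i. ball (f (fst i)) (snd i)) C"
    using disjf inj unfolding disjoint_family_on_def
    by (metis image_orthogonal_transformation_ball[OF f] image_Int image_empty)
  have sames: "emeasure lborel V = emeasure lborel A"
    if "open V" "open A" "A \<subseteq> V" "negligible (V - A)" for V A :: "'a set"
  proof -
    have "V - A \<in> null_sets lborel"
      using that by (simp add: negligible_iff_null_sets null_sets_completion_iff)
    then have "emeasure lborel (A \<union> (V - A)) = emeasure lborel A"
      using that by (intro emeasure_Un_null_set) auto
    also have "A \<union> (V - A) = V" using that by auto
    finally show ?thesis .
  qed
  have "emeasure lborel (f ` U) = emeasure lborel (f ` B)"
  proof (rule sames)
    show "open (f ` U)"
      using U lin f by (simp add: open_surjective_linear_image orthogonal_transformation_surj)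
    show "open (f ` B)" by (auto simp: fB)
    show "f ` B \<subseteq> f ` U" using \<open>B \<subseteq> U\<close> by blast
    have "negligible (f ` (U - B))"
      using neg f by (intro negligible_locally_Lipschitz_image)
        (auto simp: B_def orthogonal_transformation_isometry dist_norm[symmetric]
          intro!: exI[of _ UNIV] exI[of _ 1])
    then show "negligible (f ` U - f ` B)"
      using inj by (simp add: image_set_diff)
  qed
  also have "\<dots> = (\<integral>\<^sup>+i. emeasure lborel (ball (f (fst i)) (snd i)) \<partial>count_space C)"
    unfolding fB using C disjf' by (intro emeasure_UN_countable) auto
  also have "\<dots> = (\<integral>\<^sup>+i. emeasure lborel (ball (fst i) (snd i)) \<partial>count_space C)"
    using C by (intro nn_integral_cong) (auto simp: emeasure_ball K_def)
  also have "\<dots> = emeasure lborel B"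
    unfolding B_def using C disjf by (intro emeasure_UN_countable[symmetric]) auto
  also have "\<dots> = emeasure lborel U"
    using neg U \<open>B \<subseteq> U\<close> by (intro sames[symmetric]) (auto simp: B_def)
  finally show ?thesis .
qed

lemma orthogonal_transformation_borel_measurable:
  fixes f :: "'a::euclidean_space \<Rightarrow> 'a"
  assumes "orthogonal_transformation f"
  shows "f \<in> borel \<rightarrow>\<^sub>M borel"
  using assms
  by (intro borel_measurable_continuous_onI linear_continuous_on)
    (simp add: linear_conv_bounded_linear[symmetric] orthogonal_transformation_linear)

lemma lborel_distr_orthogonal:
  fixes f :: "'a::euclidean_space \<Rightarrow> 'a"
  assumes f: "orthogonal_transformation f"
  shows "distr lborel borel f = lborel"
proof (rule lborel_eqI[symmetric])
  fix l u :: 'a assume le: "\<And>b. b \<in> Basis \<Longrightarrow> l \<bullet> b \<le> u \<bullet> b"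
  note [measurable] = orthogonal_transformation_borel_measurable[OF f]
  have "emeasure (distr lborel borel f) (box l u) = emeasure lborel (f -` box l u)"
    by (simp add: emeasure_distr)
  also have "f -` box l u = inv f ` box l u"
    using f by (simp add: bij_vimage_eq_inv_image orthogonal_transformation_bij)
  also have "emeasure lborel \<dots> = emeasure lborel (box l u)"
    using f by (intro emeasure_lborel_orthogonal_image_open orthogonal_transformation_inv) auto
  also have "\<dots> = (\<Prod>b\<in>Basis. (u - l) \<bullet> b)"
    using le by (simp add: emeasure_lborel_box)
  finally show "emeasure (distr lborel borel f) (box l u) = (\<Prod>b\<in>Basis. (u - l) \<bullet> b)" .
qed simp

section \<open>Invariance of the uniform measures\<close>

lemma uniform_sphere_orthogonal_vimage:
  fixes f :: "'a::euclidean_space \<Rightarrow> 'a"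
  assumes f: "orthogonal_transformation f" and A[measurable]: "A \<in> sets borel"
  shows "emeasure uniform_sphere (f -` A) = emeasure uniform_sphere A"
proof -
  note [measurable] = orthogonal_transformation_borel_measurable[OF f]
  have [measurable]: "(sgn :: 'a \<Rightarrow> 'a) \<in> borel \<rightarrow>\<^sub>M borel"
    unfolding sgn_div_norm by measurable
  have sph: "emeasure uniform_sphere B =
      emeasure lborel (ball 0 1 \<inter> sgn -` B) / emeasure lborel (ball (0::'a) 1)"
    if [measurable]: "B \<in> sets borel" for B :: "'a set"
  proof -
    have [measurable]: "sgn -` B \<in> sets borel"
      using measurable_sets[of sgn borel borel B] by simp
    show ?thesis
      by (simp add: uniform_sphere_def emeasure_distr)
  qed
  have sgn_f: "sgn (f x) = f (sgn x)" for x
    using f by (simp add: sgn_div_norm orthogonal_transformation_norm orthogonal_transformation_scaleR)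
  have fA: "f -` A \<in> sets borel"
    using measurable_sets[of f borel borel A] by simp
  have sA: "sgn -` A \<in> sets borel"
    using measurable_sets[of sgn borel borel A] by simp
  have "emeasure lborel (ball 0 1 \<inter> sgn -` (f -` A)) = emeasure lborel (f -` (ball 0 1 \<inter> sgn -` A))"
    using f by (intro arg_cong[where f = "emeasure lborel"])
      (auto simp: sgn_f orthogonal_transformation_norm)
  also have "\<dots> = emeasure (distr lborel borel f) (ball 0 1 \<inter> sgn -` A)"
    using sA by (simp add: emeasure_distr)
  also have "\<dots> = emeasure lborel (ball 0 1 \<inter> sgn -` A)"
    by (simp add: lborel_distr_orthogonal[OF f])
  finally show ?thesis by (simp add: sph fA)
qed

lemma closed_upper_hemisphere: "closed (upper_hemisphere :: ((real^'n) \<times> real) set)"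
proof -
  have "closed {x :: (real^'n) \<times> real. 0 \<le> snd x}"
    by (intro closed_Collect_le continuous_intros)
  then have "closed (sphere 0 1 \<inter> {x :: (real^'n) \<times> real. 0 \<le> snd x})"
    by (intro closed_Int closed_sphere)
  also have "sphere 0 1 \<inter> {x :: (real^'n) \<times> real. 0 \<le> snd x} = upper_hemisphere"
    by (auto simp: upper_hemisphere_def)
  finally show ?thesis .
qed

lemma compact_upper_hemisphere: "compact (upper_hemisphere :: ((real^'n) \<times> real) set)"
proof -
  have "upper_hemisphere \<subseteq> (sphere 0 1 :: ((real^'n) \<times> real) set)"
    by (auto simp: upper_hemisphere_def)
  then show ?thesis
    using closed_upper_hemisphere bounded_subset[OF bounded_sphere]
    by (auto simp: compact_eq_bounded_closed)
qed

text \<open>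
  The map only has to agree with an orthogonal one on the hemisphere, as the measure does not see
  the rest of the space.
\<close>

lemma uniform_hemisphere_distr_orthogonal:
  fixes f T :: "(real^'n) \<times> real \<Rightarrow> (real^'n) \<times> real"
  assumes f: "orthogonal_transformation f" and fH: "f ` upper_hemisphere = upper_hemisphere"
    and fT: "\<And>x. x \<in> upper_hemisphere \<Longrightarrow> T x = f x"
  shows "distr uniform_hemisphere uniform_hemisphere T = uniform_hemisphere"
proof -
  let ?H = "upper_hemisphere :: ((real^'n) \<times> real) set"
  let ?P = "uniform_measure uniform_sphere ?H"
  have H: "?H \<in> sets borel" using closed_upper_hemisphere by (rule borel_closed)
  have sets_us: "sets (uniform_sphere :: ((real^'n) \<times> real) measure) = sets borel"
    by (simp add: uniform_sphere_def)
  have space_us: "space (uniform_sphere :: ((real^'n) \<times> real) measure) = UNIV"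
    by (simp add: uniform_sphere_def)
  have space_P: "space ?P = UNIV" by (simp add: space_us)
  have sets_P: "sets ?P = sets borel" by (simp add: sets_us)
  have vH: "f -` ?H = ?H"
    using inj_vimage_image_eq[OF orthogonal_transformation_inj[OF f], of ?H] fH by simp
  have meas: "T \<in> uniform_hemisphere \<rightarrow>\<^sub>M uniform_hemisphere"
  proof -
    have "f \<in> restrict_space ?P ?H \<rightarrow>\<^sub>M restrict_space ?P ?H"
      using fH orthogonal_transformation_borel_measurable[OF f]
      by (intro measurable_restrict_space3)
        (auto simp: measurable_cong_sets[OF sets_P sets_P])
    then show ?thesis
      unfolding uniform_hemisphere_def
      by (subst measurable_cong[of _ T f]) (auto simp: space_restrict_space space_P fT)
  qed
  have space_h: "space uniform_hemisphere = ?H"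
    by (simp add: uniform_hemisphere_def space_restrict_space space_us)
  have val: "emeasure uniform_hemisphere B = emeasure uniform_sphere B / emeasure uniform_sphere ?H"
    if B: "B \<in> sets borel" "B \<subseteq> ?H" for B
  proof -
    have "?H \<inter> space ?P \<in> sets ?P" by (simp only: space_P sets_P H Int_UNIV_right)
    then have "emeasure uniform_hemisphere B = emeasure ?P B"
      unfolding uniform_hemisphere_def using B(2) by (rule emeasure_restrict_space)
    also have "\<dots> = emeasure uniform_sphere (?H \<inter> B) / emeasure uniform_sphere ?H"
      using B H by (intro emeasure_uniform_measure) (auto simp: sets_us)
    also have "?H \<inter> B = B" using B by auto
    finally show ?thesis .
  qed
  show ?thesis
  proof (rule measure_eqI)
    fix A assume "A \<in> sets (distr uniform_hemisphere uniform_hemisphere T)"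
    then have Ah: "A \<in> sets uniform_hemisphere" by simp
    then have A: "A \<in> sets borel" "A \<subseteq> ?H"
      using H by (auto simp: uniform_hemisphere_def sets_restrict_space sets_us)
    have fA: "f -` A \<in> sets borel"
      using measurable_sets[OF orthogonal_transformation_borel_measurable[OF f] A(1)] by simp
    have "T -` A \<inter> ?H = f -` A \<inter> ?H"
      by (intro set_eqI) (metis Int_iff vimage_eq fT)
    also have "\<dots> = f -` A" using A vH by blast
    finally have "emeasure (distr uniform_hemisphere uniform_hemisphere T) A =
        emeasure uniform_hemisphere (f -` A)"
      using meas Ah by (simp add: emeasure_distr space_h)
    also have "\<dots> = emeasure uniform_hemisphere A"
      using A fA vH by (subst (1 2) val)
        (auto simp: uniform_sphere_orthogonal_vimage[OF f])
    finally show "emeasure (distr uniform_hemisphere uniform_hemisphere T) A =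
        emeasure uniform_hemisphere A" .
  qed simp
qed

section \<open>Rigidity of the hemisphere\<close>

text \<open>
  Both metrics decrease with the inner product. Comparing them this way puts the Lipschitz condition
  in terms of the metric of the ambient space, where compactness is available.
\<close>

lemma geodist_le_iff_dist_le:
  fixes a b c d :: "'a::real_inner"
  assumes "norm a = 1" "norm b = 1" "norm c = 1" "norm d = 1"
  shows "geodist a b \<le> geodist c d \<longleftrightarrow> dist a b \<le> dist c d"
proof -
  have bd: "\<bar>u \<bullet> v\<bar> \<le> 1" if "norm u = 1" "norm v = 1" for u v :: 'a
    using Cauchy_Schwarz_ineq2[of u v] that by simp
  have sq: "(dist u v)\<^sup>2 = 2 - 2 * (u \<bullet> v)" if "norm u = 1" "norm v = 1" for u v :: 'a
    using that by (simp add: dist_norm power2_norm_eq_inner inner_diff norm_eq_1 inner_commute)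
  have "geodist a b \<le> geodist c d \<longleftrightarrow> c \<bullet> d \<le> a \<bullet> b"
    using bd assms by (simp add: geodist_def arccos_le_mono)
  also have "\<dots> \<longleftrightarrow> (dist a b)\<^sup>2 \<le> (dist c d)\<^sup>2"
    using sq assms by simp
  also have "\<dots> \<longleftrightarrow> dist a b \<le> dist c d"
    by (simp add: abs_le_square_iff[symmetric])
  finally show ?thesis .
qed

text \<open>
  Extending \<open>T\<close> by \<open>- T (- x)\<close> to the open lower hemisphere preserves inner products, because
  changing the sign of one argument changes the sign of both inner products. On the whole sphere
  such a map extends radially to an isometry that fixes the origin, which is linear.
\<close>

lemma hemisphere_isometry_extends_orthogonal:
  fixes T :: "(real^'n) \<times> real \<Rightarrow> (real^'n) \<times> real"
  assumes maps: "\<And>x. x \<in> upper_hemisphere \<Longrightarrow> T x \<in> upper_hemisphere"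
    and iso: "\<And>x y. x \<in> upper_hemisphere \<Longrightarrow> y \<in> upper_hemisphere \<Longrightarrow> T x \<bullet> T y = x \<bullet> y"
  obtains f where "orthogonal_transformation f" "\<And>x. x \<in> upper_hemisphere \<Longrightarrow> f x = T x"
proof -
  let ?H = "upper_hemisphere :: ((real^'n) \<times> real) set"
  define F where "F x = (if snd x \<ge> 0 then T x else - T (- x))" for x
  have H: "x \<in> ?H \<longleftrightarrow> norm x = 1 \<and> snd x \<ge> 0" for x
    by (auto simp: upper_hemisphere_def)
  have inner_F: "F x \<bullet> F y = x \<bullet> y" if "norm x = 1" "norm y = 1" for x y
    using that iso[of x y] iso[of "- x" y] iso[of x "- y"] iso[of "- x" "- y"]
    by (auto simp: F_def H)
  have "\<exists>g. orthogonal_transformation g \<and> (\<forall>x. norm x = 1 \<longrightarrow> g x = F x)"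
  proof (rule isometry_sphere_extend)
    show "norm (F x) = 1" if "norm x = 1" for x
      using inner_F[OF that that] that by (simp add: norm_eq_1)
    show "dist (F x) (F y) = dist x y" if "norm x = 1" "norm y = 1" for x y
      unfolding dist_norm norm_eq using that
      by (simp add: inner_diff inner_F)
  qed
  then show thesis using that by (auto simp: F_def H)
qed

lemma eq_north_pole_if_inner_nonneg:
  fixes p :: "(real^'n) \<times> real"
  assumes p: "p \<in> upper_hemisphere" and nonneg: "\<And>y. y \<in> upper_hemisphere \<Longrightarrow> p \<bullet> y \<ge> 0"
  shows "p = north_pole"
proof -
  obtain v t where vt: "p = (v, t)" by (cases p)
  have "v = 0"
  proof (rule ccontr)
    assume "v \<noteq> 0"
    \<comment> \<open>Test against the point of the equator opposite to the horizontal direction of \<open>p\<close>.\<close>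
    have "(- sgn v, 0) \<in> upper_hemisphere"
      using \<open>v \<noteq> 0\<close> by (simp add: upper_hemisphere_def norm_Pair norm_sgn)
    from nonneg[OF this] have "(v \<bullet> v) / norm v \<le> 0"
      by (simp add: vt sgn_div_norm divide_inverse mult.commute)
    moreover have "(v \<bullet> v) / norm v > 0"
      using \<open>v \<noteq> 0\<close> by (intro divide_pos_pos) (auto simp only: inner_gt_zero_iff zero_less_norm_iff)
    ultimately show False by linarith
  qed
  with p show ?thesis
    by (auto simp: vt upper_hemisphere_def north_pole_def norm_Pair)
qed

theorem corollary6:
  fixes T :: "(real^'n) \<times> real \<Rightarrow> (real^'n) \<times> real"
  assumes "CARD('n) \<ge> 2"
    and "bij_betw T upper_hemisphere upper_hemisphere"
    and "\<forall>x\<in>upper_hemisphere. \<forall>y\<in>upper_hemisphere. geodist (T x) (T y) \<le> geodist x y"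
  shows "(\<forall>x\<in>upper_hemisphere. \<forall>y\<in>upper_hemisphere. geodist (T x) (T y) = geodist x y)
    \<and> T north_pole = north_pole
    \<and> distr uniform_hemisphere uniform_hemisphere T = uniform_hemisphere"
proof -
  let ?H = "upper_hemisphere :: ((real^'n) \<times> real) set"
  have norm1: "norm x = 1" if "x \<in> ?H" for x
    using that by (simp add: upper_hemisphere_def)
  have surj: "T ` ?H = ?H" using assms(2) by (rule bij_betw_imp_surj_on)
  then have maps: "T x \<in> ?H" if "x \<in> ?H" for x using that by blast
  have iso: "dist (T x) (T y) = dist x y" if "x \<in> ?H" "y \<in> ?H" for x y
  proof (rule compact_nonexpansive_surj_isometry[OF compact_upper_hemisphere surj _ that])
    show "dist (T x) (T y) \<le> dist x y" if "x \<in> ?H" "y \<in> ?H" for x y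
      using assms(3) that
      by (simp add: geodist_le_iff_dist_le[symmetric] norm1 maps)
  qed
  have inner_T: "T x \<bullet> T y = x \<bullet> y" if "x \<in> ?H" "y \<in> ?H" for x y
    using iso[OF that] norm1[OF that(1)] norm1[OF that(2)] norm1[OF maps[OF that(1)]]
      norm1[OF maps[OF that(2)]]
    by (simp add: dist_norm dot_norm_neg)
  have N: "north_pole \<in> ?H"
    by (simp add: north_pole_def upper_hemisphere_def norm_Pair)
  have "T north_pole = north_pole"
  proof (rule eq_north_pole_if_inner_nonneg[OF maps[OF N]])
    fix y assume "y \<in> ?H"
    then obtain x where x: "x \<in> ?H" "y = T x" using surj by blast
    then show "T north_pole \<bullet> y \<ge> 0"
      by (simp add: inner_T N) (simp add: north_pole_def upper_hemisphere_def inner_prod_def)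
  qed
  moreover obtain f where f: "orthogonal_transformation f" "\<And>x. x \<in> ?H \<Longrightarrow> f x = T x"
    using hemisphere_isometry_extends_orthogonal[OF maps inner_T] by blast
  moreover have fH: "f ` ?H = ?H" using surj f(2) by simp
  moreover from f fH have "distr uniform_hemisphere uniform_hemisphere T = uniform_hemisphere"
    by (intro uniform_hemisphere_distr_orthogonal[of f]) auto
  ultimately show ?thesis by (simp add: geodist_def inner_T)
qed

end
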